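(* Let $d\in\mathbb{N}$, $\alpha\in(0,2)$, $m\ge 0$, $a,v>0$, and suppose that $H_{m,\alpha}=L_{m,\alpha}-v\mathbf{1}_{\mathcal{B}_a}$ has a ground state $\varphi_0$, with eigenvalue $\lambda_0$. Let $\mathbf{a}=(a,0,\ldots,0)\in\mathbb{R}^d$, $\kappa=\frac{v-|\lambda_0|}{\lambda_a-v+|\lambda_0|}$ and $\mathcal{I}=\int_1^\infty r^{d-1}j_{m,\alpha}^2(ar)\,dr$. Let $C\ge 1$ be a constant (depending on $d,m,\alpha,a,v,|\lambda_0|$) such that $$\frac1C\varphi_0(\mathbf{a})\Big(1+\kappa\big(\tfrac{a-|x|}{a}\big)^{\alpha/2}\Big)\le\varphi_0(x)\le C\varphi_0(\mathbf{a})\Big(1+\kappa\big(\tfrac{a-|x|}{a}\big)^{\alpha/2}\Big)\ \ (|x|\le a),$$ $$\frac1C\varphi_0(\mathbf{a})j_{m,\alpha}(|x|)\le\varphi_0(x)\le C\varphi_0(\mathbf{a})j_{m,\alpha}(|x|)\ \ (|x|\ge a).$$ Then, with the same constant $C$, $$\frac1C\,Q^{-1/2}\le\varphi_0(\mathbf{a})\le C\,Q^{-1/2},\qquad Q=a^d\,d\,\omega_d\left(\frac1d+2\kappa\,B\big(d,1+\tfrac{\alpha}{2}\big)+\kappa^2B(d,1+\alpha)+\mathcal{I}\right).$$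
   Context: For $z\ge 0$ let $\Phi_{m,\alpha}(z)=(z+m^{2/\alpha})^{\alpha/2}-m$, and let $L_{m,\alpha}=\Phi_{m,\alpha}(-\Delta)$ be the self-adjoint operator on $L^2(\mathbb{R}^d)$ given by the Fourier multiplier $\Phi_{m,\alpha}(|y|^2)$. Its jump kernel is, for $r>0$, $$j_{m,\alpha}(r)=\frac{2^{\frac{\alpha-d}{2}}m^{\frac{d+\alpha}{2\alpha}}\alpha}{\pi^{d/2}\Gamma(1-\frac{\alpha}{2})}\,\frac{K_{(d+\alpha)/2}(m^{1/\alpha}r)}{r^{(d+\alpha)/2}}\ (m>0),\qquad j_{0,\alpha}(r)=\frac{2^\alpha\Gamma(\frac{d+\alpha}{2})}{\pi^{d/2}|\Gamma(-\frac{\alpha}{2})|}\,r^{-d-\alpha},$$ with $K_\rho$ the modified Bessel function of the third kind, $K_\rho(z)=\frac12(\frac z2)^\rho\int_0^\infty t^{-\rho-1}e^{-t-\frac{z^2}{4t}}dt$. $\mathcal{B}_a$ is the open ball of radius $a$ centred at $0$, $\omega_d=|\mathcal{B}_1|$ is the volume of the unit ball, and $B(x,y)$ is the usual Beta function. $\lambda_a$ is the principal Dirichlet eigenvalue of $L_{m,\alpha}$ in $\mathcal{B}_a$, i.e. the smallest eigenvalue of minus the generator of the semigroup on $L^2(\mathcal{B}_a)$ of the L\'evy process with generator $-L_{m,\alpha}$ killed on exiting $\mathcal{B}_a$. A ground state of $H_{m,\alpha}$ is a nonzero $\varphi_0\in\mathrm{Dom}(H_{m,\alpha})$ with $H_{m,\alpha}\varphi_0=\lambda_0\varphi_0$,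 where $\lambda_0=\inf\mathrm{Spec}\,H_{m,\alpha}\in(-v,0)$. If it exists it is unique up to a scalar multiple, bounded and continuous, and it is always chosen strictly positive with $\|\varphi_0\|_{L^2}=1$. It is known that $v-|\lambda_0|<\lambda_a$. *)

theory Defs
  imports "HOL-Probability.Probability"
begin

section \<open>The space \<open>L\<^sup>2\<close> and unbounded operators on it\<close>

text \<open>
  Elements of complex \<open>L\<^sup>2(M)\<close> are represented by square integrable functions, identified up to
  almost everywhere equality. The squared norm takes values in \<open>[0,\<infinity>]\<close>, so that convergence to
  \<open>0\<close> of a squared norm is never satisfied because of a junk value of the Bochner integral.
\<close>

definition L2_sqnorm :: "'a measure \<Rightarrow> ('a \<Rightarrow> complex) \<Rightarrow> ennreal" where
  "L2_sqnorm M f = (\<integral>\<^sup>+x. ennreal ((cmod (f x))\<^sup>2) \<partial>M)"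

definition L2_space :: "'a measure \<Rightarrow> ('a \<Rightarrow> complex) set" where
  "L2_space M = {f \<in> borel_measurable M. L2_sqnorm M f < \<infinity>}"

text \<open>
  A (partially defined) linear operator \<open>T\<close> is represented by its graph: \<open>T f g\<close> means that \<open>f\<close>
  lies in the domain and \<open>T f = g\<close> in \<open>L\<^sup>2(M)\<close>.
\<close>

type_synonym 'a operator = "('a \<Rightarrow> complex) \<Rightarrow> ('a \<Rightarrow> complex) \<Rightarrow> bool"

text \<open>
  \<open>z\<close> is in the resolvent set iff \<open>T - z\<close> maps the domain onto \<open>L\<^sup>2(M)\<close> and has a bounded inverse;
  the second conjunct contains the injectivity of \<open>T - z\<close>.
\<close>

definition resolvent_set :: "'a measure \<Rightarrow> 'a operator \<Rightarrow> complex set" where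
  "resolvent_set M T = {z.
     (\<forall>h\<in>L2_space M. \<exists>f g. T f g \<and> (AE x in M. g x - z * f x = h x)) \<and>
     (\<exists>K::real. \<forall>f g. T f g \<longrightarrow>
        L2_sqnorm M f \<le> ennreal K * L2_sqnorm M (\<lambda>x. g x - z * f x))}"

definition spectrum :: "'a measure \<Rightarrow> 'a operator \<Rightarrow> complex set" where
  "spectrum M T = - resolvent_set M T"

text \<open>The generator of an operator semigroup \<open>P\<close> on \<open>L\<^sup>2(M)\<close>: the strong derivative at \<open>0+\<close>.\<close>

definition L2_generator ::
    "'a measure \<Rightarrow> (real \<Rightarrow> ('a \<Rightarrow> complex) \<Rightarrow> 'a \<Rightarrow> complex) \<Rightarrow> 'a operator" where
  "L2_generator M P f g \<longleftrightarrow> f \<in> L2_space M \<and> g \<in> L2_space M \<and>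
     ((\<lambda>t. L2_sqnorm M (\<lambda>x. (P t f x - f x) / complex_of_real t - g x)) \<longlongrightarrow> 0) (at_right 0)"


section \<open>The operators \<open>L\<close> and \<open>H\<close>\<close>

definition fourier_integral ::
    "('a::euclidean_space \<Rightarrow> complex) \<Rightarrow> 'a \<Rightarrow> complex" where
  "fourier_integral f y =
     complex_of_real ((2 * pi) powr (- real DIM('a) / 2)) *
     (\<integral>x. exp (- \<i> * complex_of_real (x \<bullet> y)) * f x \<partial>lborel)"

text \<open>
  The Fourier--Plancherel transform of \<open>f \<in> L\<^sup>2\<close> is the \<open>L\<^sup>2\<close>-limit of the Fourier integrals of the
  truncations of \<open>f\<close> to balls of radius \<open>n\<close>.
\<close>

definition fourier_L2 ::
    "('a::euclidean_space \<Rightarrow> complex) \<Rightarrow> ('a \<Rightarrow> complex) \<Rightarrow> bool" where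
  "fourier_L2 f F \<longleftrightarrow> f \<in> L2_space lborel \<and> F \<in> L2_space lborel \<and>
     (\<lambda>n. L2_sqnorm lborel (\<lambda>y.
        fourier_integral (\<lambda>x. indicator (ball 0 (real n)) x * f x) y - F y)) \<longlonglongrightarrow> 0"

definition Phi :: "real \<Rightarrow> real \<Rightarrow> real \<Rightarrow> real" where
  "Phi m \<alpha> z = (z + m powr (2/\<alpha>)) powr (\<alpha>/2) - m"

definition L_op :: "real \<Rightarrow> real \<Rightarrow> 'a::euclidean_space operator" where
  "L_op m \<alpha> f g \<longleftrightarrow> f \<in> L2_space lborel \<and> g \<in> L2_space lborel \<and>
     (\<exists>F G. fourier_L2 f F \<and> fourier_L2 g G \<and>
        (AE y in lborel. G y = complex_of_real (Phi m \<alpha> ((norm y)\<^sup>2)) * F y))"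

definition H_op :: "real \<Rightarrow> real \<Rightarrow> real \<Rightarrow> real \<Rightarrow> 'a::euclidean_space operator" where
  "H_op m \<alpha> a v f g \<longleftrightarrow> g \<in> L2_space lborel \<and>
     (\<exists>h. L_op m \<alpha> f h \<and>
        (AE x in lborel. g x = h x - complex_of_real v * indicator (ball 0 a) x * f x))"

text \<open>
  The spectrum of \<open>H\<close> is real, \<open>H\<close> being self-adjoint, so that taking real parts below only
  changes the type.
\<close>

definition ground_state ::
    "real \<Rightarrow> real \<Rightarrow> real \<Rightarrow> real \<Rightarrow> ('a::euclidean_space \<Rightarrow> real) \<Rightarrow> real \<Rightarrow> bool" where
  "ground_state m \<alpha> a v \<phi> lam0 \<longleftrightarrow>
     lam0 = Inf (Re ` spectrum lborel (H_op m \<alpha> a v :: 'a operator)) \<and> - v < lam0 \<and> lam0 < 0 \<and>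
     \<not> (AE x in lborel. \<phi> x = 0) \<and>
     H_op m \<alpha> a v (\<lambda>x. complex_of_real (\<phi> x)) (\<lambda>x. complex_of_real (lam0 * \<phi> x))"


section \<open>The jump kernel\<close>

definition bessel_K :: "real \<Rightarrow> real \<Rightarrow> real" where
  "bessel_K \<rho> z = 1/2 * (z/2) powr \<rho> *
     (LBINT t:{0<..}. t powr (- \<rho> - 1) * exp (- t - z\<^sup>2 / (4 * t)))"

definition jump_kernel :: "nat \<Rightarrow> real \<Rightarrow> real \<Rightarrow> real \<Rightarrow> real" where
  "jump_kernel d m \<alpha> r =
     (if m > 0 then
        2 powr ((\<alpha> - real d) / 2) * m powr ((real d + \<alpha>) / (2 * \<alpha>)) * \<alpha>
          / (pi powr (real d / 2) * Gamma (1 - \<alpha>/2))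
        * (bessel_K ((real d + \<alpha>) / 2) (m powr (1/\<alpha>) * r) / r powr ((real d + \<alpha>) / 2))
      else
        2 powr \<alpha> * Gamma ((real d + \<alpha>) / 2) / (pi powr (real d / 2) * \<bar>Gamma (- \<alpha>/2)\<bar>)
        * r powr (- real d - \<alpha>))"


section \<open>L\'evy processes and the principal Dirichlet eigenvalue\<close>

definition levy_process :: "'w measure \<Rightarrow> (real \<Rightarrow> 'w \<Rightarrow> 'a::euclidean_space) \<Rightarrow> bool" where
  "levy_process \<Omega> X \<longleftrightarrow> prob_space \<Omega> \<and>
     (\<forall>t\<ge>0. X t \<in> borel_measurable \<Omega>) \<and>
     (AE \<omega> in \<Omega>. X 0 \<omega> = 0) \<and>
     (\<forall>(n::nat) \<tau>::nat \<Rightarrow> real. 0 \<le> \<tau> 0 \<and> mono \<tau> \<longrightarrow>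
        prob_space.indep_vars \<Omega> (\<lambda>_. borel)
          (\<lambda>k \<omega>. X (\<tau> (Suc k)) \<omega> - X (\<tau> k) \<omega>) {..<n}) \<and>
     (\<forall>s\<ge>0. \<forall>t\<ge>0. distr \<Omega> borel (\<lambda>\<omega>. X (s + t) \<omega> - X s \<omega>) = distr \<Omega> borel (X t)) \<and>
     (AE \<omega> in \<Omega>. \<forall>t\<ge>0. ((\<lambda>s. X s \<omega>) \<longlongrightarrow> X t \<omega>) (at_right t) \<and>
        (t > 0 \<longrightarrow> (\<exists>l. ((\<lambda>s. X s \<omega>) \<longlongrightarrow> l) (at_left t))))"

definition transition_semigroup ::
    "'w measure \<Rightarrow> (real \<Rightarrow> 'w \<Rightarrow> 'a::euclidean_space) \<Rightarrow> real \<Rightarrow> ('a \<Rightarrow> complex) \<Rightarrow> 'a \<Rightarrow> complex"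
  where
  "transition_semigroup \<Omega> X t f x = (\<integral>\<omega>. f (x + X t \<omega>) \<partial>\<Omega>)"

definition exit_time ::
    "(real \<Rightarrow> 'w \<Rightarrow> 'a::euclidean_space) \<Rightarrow> 'a set \<Rightarrow> 'a \<Rightarrow> 'w \<Rightarrow> ereal" where
  "exit_time X U x \<omega> = Inf {ereal s | s. s > 0 \<and> x + X s \<omega> \<notin> U}"

text \<open>
  The expectation is taken over the completion of \<open>\<Omega>\<close>, because exit times are in general only
  measurable with respect to the completed \<open>\<sigma>\<close>-algebra.
\<close>

definition killed_semigroup ::
    "'w measure \<Rightarrow> (real \<Rightarrow> 'w \<Rightarrow> 'a::euclidean_space) \<Rightarrow> 'a set \<Rightarrow>
     real \<Rightarrow> ('a \<Rightarrow> complex) \<Rightarrow> 'a \<Rightarrow> complex" where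
  "killed_semigroup \<Omega> X U t f x =
     (\<integral>\<omega>. (if ereal t < exit_time X U x \<omega> then f (x + X t \<omega>) else 0) \<partial>completion \<Omega>)"

definition dirichlet_eigenvalue ::
    "'w measure \<Rightarrow> (real \<Rightarrow> 'w \<Rightarrow> 'a::euclidean_space) \<Rightarrow> 'a set \<Rightarrow> real \<Rightarrow> bool" where
  "dirichlet_eigenvalue \<Omega> X U \<mu> \<longleftrightarrow>
     (\<exists>f. \<not> (AE x in restrict_space lborel U. f x = 0) \<and>
        L2_generator (restrict_space lborel U) (killed_semigroup \<Omega> X U)
          f (\<lambda>x. - complex_of_real \<mu> * f x))"

definition principal_dirichlet_eigenvalue ::
    "'w measure \<Rightarrow> (real \<Rightarrow> 'w \<Rightarrow> 'a::euclidean_space) \<Rightarrow> 'a set \<Rightarrow> real" where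
  "principal_dirichlet_eigenvalue \<Omega> X U = (LEAST \<mu>. dirichlet_eigenvalue \<Omega> X U \<mu>)"

end

theory Submission
  imports Defs
begin

text \<open>
  The two bounds say that \<open>\<phi>0\<close> is comparable, up to the factor \<open>C\<close>, to \<open>\<phi>0 \<aa>\<close> times a radial
  profile \<open>g\<close>. Squaring and integrating turns \<open>\<parallel>\<phi>0\<parallel> = 1\<close> into a two-sided bound of \<open>(\<phi>0 \<aa>)\<^sup>2 \<parallel>g\<parallel>\<^sup>2\<close>
  by powers of \<open>C\<close>, and \<open>\<parallel>g\<parallel>\<^sup>2\<close> is computed to be \<open>Q\<close> in polar coordinates: the interior gives the
  Beta functions and the exterior gives \<open>\<I>\<close>.
\<close>

text \<open>Differentiating the ball volume \<open>?c * r ^ d\<close> gives the radial density. Two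
  measures that agree and are finite on the half-lines \<open>{..r}\<close> coincide, because these
  half-lines are stable under intersection and generate the Borel sets. The term
  \<open>max 0 r\<close> covers the half-lines with negative \<open>r\<close>, which have measure
  0.\<close>

lemma distr_lborel_norm:
  "distr (lborel :: 'a::euclidean_space measure) borel norm =
   density lborel (\<lambda>r. ennreal (real DIM('a) * measure lborel (ball 0 1 :: 'a set) * r ^ (DIM('a) - 1))
     * indicator {0..} r)"
  (is "?M = ?N")
proof (rule measure_eqI_generator_eq[where E="range (\<lambda>r::real. {..r})" and \<Omega>=UNIV and A="\<lambda>n. {..real n}"])
  let ?d = "DIM('a)" and ?c = "measure lborel (ball 0 1 :: 'a set)"
  have c: "?c = unit_ball_vol ?d"
    using content_ball[of 1 "0::'a"] by simp
  have M: "emeasure ?M {..r} = ennreal (?c * max 0 r ^ ?d)" for r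
  proof -
    have "emeasure ?M {..r} = emeasure lborel (norm -` {..r} :: 'a set)"
      by (subst emeasure_distr) auto
    also have "norm -` {..r} = (cball 0 r :: 'a set)" by auto
    also have "emeasure lborel \<dots> = ennreal (?c * max 0 r ^ ?d)"
      using emeasure_cball[of r "0::'a"] c by (cases "r \<ge> 0") (auto simp: max_def)
    finally show ?thesis .
  qed
  have N: "emeasure ?N {..r} = ennreal (?c * max 0 r ^ ?d)" for r
  proof -
    have "emeasure ?N {..r} = (\<integral>\<^sup>+x. ennreal (real ?d * ?c * x ^ (?d - 1)) * indicator {0..max 0 r} x \<partial>lborel)"
    proof (subst emeasure_density, simp, simp, rule nn_integral_cong_AE)
      \<comment> \<open>For \<open>r < 0\<close> the right-hand interval degenerates to
        \<open>{0..0}\<close> while the left-hand product of indicators vanishes, so equality can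
        fail at the point 0.\<close>
      show "AE x in lborel. ennreal (real ?d * ?c * x ^ (?d - 1)) * indicator {0..} x * indicator {..r} x
        = ennreal (real ?d * ?c * x ^ (?d - 1)) * indicator {0..max 0 r} x"
        using AE_lborel_singleton[of "0::real"] by eventually_elim (auto simp: indicator_def max_def)
    qed
    also have "\<dots> = ennreal (?c * max 0 r ^ ?d - ?c * 0 ^ ?d)"
      by (rule nn_integral_FTC_Icc[where F="\<lambda>x. ?c * x ^ ?d"])
         (auto intro!: derivative_eq_intros)
    finally show ?thesis by simp
  qed
  show "emeasure ?M Y = emeasure ?N Y" if "Y \<in> range (\<lambda>r::real. {..r})" for Y
    using that M N by auto
  show "emeasure ?M {..real n} \<noteq> \<infinity>" for n by (simp add: M)
  show "(\<Union>n. {..real n}) = (UNIV :: real set)"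
    using real_arch_simple by auto
  show "Int_stable (range (\<lambda>r::real. {..r}))"
    by (auto simp: Int_stable_def)
  show "sets ?M = sigma_sets UNIV (range (\<lambda>r::real. {..r}))"
    "sets ?N = sigma_sets UNIV (range (\<lambda>r::real. {..r}))"
    using arg_cong[OF borel_eq_atMost[where 'a=real], of sets] by auto
qed auto

text \<open>Polar coordinates with the radius measured in units of \<open>a\<close>, so that the
  sphere of radius \<open>a\<close> lies at \<open>r = 1\<close>. The substitution contributes one
  factor \<open>a\<close>, the density the other \<open>d - 1\<close>. With values in
  \<open>ennreal\<close> no integrability has to be known beforehand.\<close>

lemma nn_integral_radial:
  fixes f :: "real \<Rightarrow> ennreal"
  assumes [measurable]: "f \<in> borel_measurable borel" and "0 < a"
  shows "(\<integral>\<^sup>+x. f (norm (x::'a::euclidean_space)) \<partial>lborel) =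
    ennreal (a ^ DIM('a) * real DIM('a) * measure lborel (ball 0 1 :: 'a set)) *
    (\<integral>\<^sup>+r. indicator {0..} r * ennreal (r ^ (DIM('a) - 1)) * f (a * r) \<partial>lborel)"
proof -
  let ?d = "DIM('a)" and ?c = "measure lborel (ball 0 1 :: 'a set)"
  have "(\<integral>\<^sup>+x. f (norm (x::'a)) \<partial>lborel) = (\<integral>\<^sup>+r. f r \<partial>distr (lborel :: 'a measure) borel norm)"
    by (subst nn_integral_distr) auto
  also have "\<dots> = (\<integral>\<^sup>+r. ennreal (real ?d * ?c * r ^ (?d - 1)) * indicator {0..} r * f r \<partial>lborel)"
    unfolding distr_lborel_norm by (subst nn_integral_density) auto
  also have "\<dots> = ennreal a * (\<integral>\<^sup>+r. ennreal (real ?d * ?c * (a * r) ^ (?d - 1)) * indicator {0..} (a * r) * f (a * r) \<partial>lborel)"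
    using \<open>0 < a\<close> by (subst nn_integral_real_affine[where c=a and t=0]) auto
  also have "\<dots> = ennreal a * (\<integral>\<^sup>+r. ennreal (real ?d * ?c * a ^ (?d - 1)) *
      (indicator {0..} r * ennreal (r ^ (?d - 1)) * f (a * r)) \<partial>lborel)"
    using \<open>0 < a\<close>
    by (intro arg_cong[where f="\<lambda>x. _ * x"] nn_integral_cong)
       (auto simp: indicator_def power_mult_distrib ennreal_mult zero_le_mult_iff mult_ac)
  also have "\<dots> = ennreal (a * (real ?d * ?c * a ^ (?d - 1))) *
      (\<integral>\<^sup>+r. indicator {0..} r * ennreal (r ^ (?d - 1)) * f (a * r) \<partial>lborel)"
    using \<open>0 < a\<close> by (subst nn_integral_cmult) (auto simp: ennreal_mult mult_ac)
  also have "a * (real ?d * ?c * a ^ (?d - 1)) = a ^ ?d * real ?d * ?c"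
    using power_minus_mult[of ?d a] by (simp add: mult_ac)
  finally show ?thesis .
qed

lemma measurable_bessel_K [measurable]: "bessel_K \<rho> \<in> borel_measurable borel"
  unfolding bessel_K_def set_lebesgue_integral_def by measurable

lemma measurable_jump_kernel [measurable]: "jump_kernel d m \<alpha> \<in> borel_measurable borel"
  unfolding jump_kernel_def by measurable

text \<open>Expanding the square leaves a monomial and two Beta integrals, with exponents
  \<open>\<beta>\<close> and \<open>2 * \<beta>\<close> of \<open>1 - r\<close>.\<close>

lemma has_integral_radial_profile:
  fixes \<kappa> \<beta> :: real
  assumes "0 < d" "0 < \<beta>"
  shows "((\<lambda>r. r ^ (d - 1) * (1 + \<kappa> * (1 - r) powr \<beta>)\<^sup>2) has_integral
    1 / real d + 2 * \<kappa> * Beta (real d) (1 + \<beta>) + \<kappa>\<^sup>2 * Beta (real d) (1 + 2 * \<beta>)) {0..1}"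
proof -
  have B: "((\<lambda>r. r ^ (d - 1) * (1 - r) powr b) has_integral Beta (real d) (1 + b)) {0..1}"
    if "0 < b" for b
  proof (rule has_integral_spike[OF _ _ has_integral_Beta_real[of "real d" "1 + b"]])
    \<comment> \<open>For \<open>d = 1\<close> the integrands differ at 0, since
      \<open>0 ^ 0 = 1\<close> but \<open>0 powr 0 = 0\<close>.\<close>
    show "negligible {0::real}" by simp
  qed (use assms that in \<open>auto simp: powr_realpow[symmetric] of_nat_diff\<close>)
  have "((\<lambda>r. r ^ (d - 1)) has_integral 1 ^ d / real d - 0 ^ d / real d) {0..1::real}"
    using assms
    by (intro fundamental_theorem_of_calculus)
       (auto simp flip: has_real_derivative_iff_has_vector_derivative intro!: derivative_eq_intros)
  from has_integral_add[OF has_integral_add[OF this has_integral_mult_right[OF B[of \<beta>], of "2 * \<kappa>"]]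
    has_integral_mult_right[OF B[of "2 * \<beta>"], of "\<kappa>\<^sup>2"]] assms
  show ?thesis
    by (simp add: power2_eq_square zero_power algebra_simps flip: powr_add)
qed
theorem proposition5p3:
  fixes m \<alpha> a v lam0 C :: real
    and \<phi>0 :: "real ^ 'n \<Rightarrow> real"
    and \<Omega> :: "'w measure"
    and X :: "real \<Rightarrow> 'w \<Rightarrow> real ^ 'n"
    and i :: 'n
  defines "d \<equiv> CARD('n)"
    and "\<aa> \<equiv> axis i a :: real ^ 'n"
    and "\<omega>d \<equiv> measure lborel (ball 0 1 :: (real ^ 'n) set)"
    and "lam_a \<equiv> principal_dirichlet_eigenvalue \<Omega> X (ball 0 a)"
  defines "\<kappa> \<equiv> (v - \<bar>lam0\<bar>) / (lam_a - v + \<bar>lam0\<bar>)"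
    and "\<I> \<equiv> (LBINT r:{1..}. r ^ (d - 1) * (jump_kernel d m \<alpha> (a * r))\<^sup>2)"
  defines "Q \<equiv> a ^ d * real d * \<omega>d *
      (1 / real d + 2 * \<kappa> * Beta (real d) (1 + \<alpha>/2) + \<kappa>\<^sup>2 * Beta (real d) (1 + \<alpha>) + \<I>)"
  assumes "0 < \<alpha>" "\<alpha> < 2" "0 \<le> m" "0 < a" "0 < v"
    and levy: "levy_process \<Omega> X"
    and gen: "\<And>f g. L2_generator lborel (transition_semigroup \<Omega> X) f g \<longleftrightarrow> L_op m \<alpha> f (\<lambda>x. - g x)"
    and ground: "ground_state m \<alpha> a v \<phi>0 lam0"
    and cont: "continuous_on UNIV \<phi>0"
    and pos: "\<And>x. 0 < \<phi>0 x"
    and normalized: "L2_sqnorm lborel (\<lambda>x. complex_of_real (\<phi>0 x)) = 1"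
    and "1 \<le> C"
    and inside: "\<And>x. norm x \<le> a \<Longrightarrow>
      1 / C * \<phi>0 \<aa> * (1 + \<kappa> * ((a - norm x) / a) powr (\<alpha>/2)) \<le> \<phi>0 x \<and>
      \<phi>0 x \<le> C * \<phi>0 \<aa> * (1 + \<kappa> * ((a - norm x) / a) powr (\<alpha>/2))"
    and outside: "\<And>x. a \<le> norm x \<Longrightarrow>
      1 / C * \<phi>0 \<aa> * jump_kernel d m \<alpha> (norm x) \<le> \<phi>0 x \<and>
      \<phi>0 x \<le> C * \<phi>0 \<aa> * jump_kernel d m \<alpha> (norm x)"
  shows "1 / C * Q powr (- 1/2) \<le> \<phi>0 \<aa> \<and> \<phi>0 \<aa> \<le> C * Q powr (- 1/2)"
proof -
  define g where "g r = (if r \<le> a then 1 + \<kappa> * ((a - r) / a) powr (\<alpha>/2) else jump_kernel d m \<alpha> r)" for r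
  define P where "P = \<phi>0 \<aa>"
  have P: "0 < P" and C: "0 < C" and d: "0 < d" and d_eq: "DIM(real ^ 'n) = d"
    using pos \<open>1 \<le> C\<close> by (auto simp: P_def d_def)
  have g_lower: "P / C * g (norm x) \<le> \<phi>0 x" and g_upper: "\<phi>0 x \<le> C * P * g (norm x)" for x
    using inside[of x] outside[of x] by (auto simp: g_def P_def)
  \<comment> \<open>Whatever the sign of \<open>\<kappa>\<close>, the upper bound together with \<open>\<phi>0 > 0\<close> makes the profile positive.\<close>
  have g_pos: "0 < g (norm x)" for x :: "real ^ 'n"
    using less_le_trans[OF pos[of x] g_upper[of x]] mult_pos_pos[OF C P] by (simp add: zero_less_mult_iff)
  have [measurable]: "g \<in> borel_measurable borel"
    unfolding g_def by measurable
  have [measurable]: "\<phi>0 \<in> borel_measurable borel"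
    using cont by (rule borel_measurable_continuous_onI)
  define G where "G = (\<integral>\<^sup>+x. ennreal ((g (norm (x :: real ^ 'n)))\<^sup>2) \<partial>lborel)"
  have norm1: "(\<integral>\<^sup>+x. ennreal ((\<phi>0 x)\<^sup>2) \<partial>lborel) = 1"
    using normalized by (simp add: L2_sqnorm_def)
  have "ennreal ((P / C)\<^sup>2) * G = (\<integral>\<^sup>+x. ennreal ((P / C * g (norm (x :: real ^ 'n)))\<^sup>2) \<partial>lborel)"
    unfolding G_def
    by (subst nn_integral_cmult[symmetric]) (auto simp: power_mult_distrib power_divide simp flip: ennreal_mult)
  \<comment> \<open>Squaring keeps the inequality because \<open>g_pos\<close> makes its smaller
    side nonnegative.\<close>
  also have "\<dots> \<le> (\<integral>\<^sup>+x. ennreal ((\<phi>0 x)\<^sup>2) \<partial>lborel)"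
    using g_pos g_lower P C
    by (intro nn_integral_mono ennreal_leI power_mono) (auto intro!: mult_nonneg_nonneg less_imp_le)
  finally have G_le: "ennreal ((P / C)\<^sup>2) * G \<le> 1" using norm1 by simp
  have "1 \<le> (\<integral>\<^sup>+x. ennreal ((C * P * g (norm (x :: real ^ 'n)))\<^sup>2) \<partial>lborel)"
    unfolding norm1[symmetric] using pos g_upper
    by (intro nn_integral_mono ennreal_leI power_mono) (auto intro: less_imp_le)
  also have "\<dots> = ennreal ((C * P)\<^sup>2) * G"
    unfolding G_def
    by (subst nn_integral_cmult[symmetric]) (auto simp: power_mult_distrib power_divide simp flip: ennreal_mult)
  finally have G_ge: "1 \<le> ennreal ((C * P)\<^sup>2) * G" .
  \<comment> \<open>The profile is square integrable because it is dominated by a multiple of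
    \<open>\<phi>0\<close>, whose norm is 1.\<close>
  have G_fin: "G \<noteq> \<infinity>"
    using G_le P C by (auto simp: ennreal_mult_top top_unique)

  define A where "A = a ^ d * real d * \<omega>d"
  define E where "E = 1 / real d + 2 * \<kappa> * Beta (real d) (1 + \<alpha>/2) + \<kappa>\<^sup>2 * Beta (real d) (1 + \<alpha>)"
  define J where "J = (\<integral>\<^sup>+r. indicator {1..} r * ennreal (r ^ (d - 1) * (jump_kernel d m \<alpha> (a * r))\<^sup>2) \<partial>lborel)"
  have A: "0 < A"
    using \<open>0 < a\<close> d by (auto simp: A_def \<omega>d_def intro!: mult_pos_pos content_ball_pos)
  have E_int: "((\<lambda>r. r ^ (d - 1) * (1 + \<kappa> * (1 - r) powr (\<alpha>/2))\<^sup>2) has_integral E) {0..1}"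
    using has_integral_radial_profile[of d "\<alpha>/2" \<kappa>] d \<open>0 < \<alpha>\<close> by (simp add: E_def)
  \<comment> \<open>The closed formula does not show this when \<kappa> is negative; the integral of
    a power times a square does.\<close>
  have E: "0 \<le> E"
    using E_int by (rule has_integral_nonneg) auto
  have "G = ennreal A * (\<integral>\<^sup>+r. indicator {0..} r * ennreal (r ^ (d - 1)) * ennreal ((g (a * r))\<^sup>2) \<partial>lborel)"
    unfolding G_def A_def \<omega>d_def
    using nn_integral_radial[where 'a="real ^ 'n", of "\<lambda>r. ennreal ((g r)\<^sup>2)", OF _ \<open>0 < a\<close>] d_eq by simp
  also have "(\<integral>\<^sup>+r. indicator {0..} r * ennreal (r ^ (d - 1)) * ennreal ((g (a * r))\<^sup>2) \<partial>lborel) =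
    (\<integral>\<^sup>+r. ennreal (indicator {0..1} r * (r ^ (d - 1) * (1 + \<kappa> * (1 - r) powr (\<alpha>/2))\<^sup>2)) +
       indicator {1..} r * ennreal (r ^ (d - 1) * (jump_kernel d m \<alpha> (a * r))\<^sup>2) \<partial>lborel)"
  proof (rule nn_integral_cong_AE)
    have scale: "(a - a * r) / a = 1 - r" for r
      using \<open>0 < a\<close> by (simp add: field_simps)
    \<comment> \<open>At \<open>r = 1\<close> both indicators on the right equal 1, so this point is
      left out.\<close>
    show "AE r in lborel. indicator {0..} r * ennreal (r ^ (d - 1)) * ennreal ((g (a * r))\<^sup>2) =
      ennreal (indicator {0..1} r * (r ^ (d - 1) * (1 + \<kappa> * (1 - r) powr (\<alpha>/2))\<^sup>2)) +
       indicator {1..} r * ennreal (r ^ (d - 1) * (jump_kernel d m \<alpha> (a * r))\<^sup>2)"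
      using AE_lborel_singleton[of "1::real"]
      by eventually_elim (use \<open>0 < a\<close> in \<open>auto simp: g_def scale indicator_def ennreal_mult\<close>)
  qed
  also have "\<dots> = ennreal E + J"
    unfolding J_def
    using nn_integral_has_integral_lebesgue[OF _ E_int] by (subst nn_integral_add) auto
  finally have G_eq: "G = ennreal A * (ennreal E + J)" .
  \<comment> \<open>Finiteness of \<open>J\<close> passes from \<open>G\<close> because
    \<open>A > 0\<close>. It guarantees that the Bochner integral \<open>\<I>\<close> is the true
    value of the exterior integral and not the default 0.\<close>
  have "J \<noteq> \<infinity>"
    using G_fin A unfolding G_eq by (auto simp: ennreal_mult_top)
  moreover have "\<I> = enn2real J"
    unfolding \<I>_def J_def set_lebesgue_integral_def
    by (subst integral_eq_nn_integral)
       (auto simp: indicator_def intro!: arg_cong[where f=enn2real] nn_integral_cong)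
  ultimately have J: "J = ennreal \<I>" and \<I>: "0 \<le> \<I>"
    by (simp_all add: ennreal_enn2real_if)
  have Q_eq: "Q = A * (E + \<I>)"
    by (simp add: Q_def A_def E_def)
  have GQ: "G = ennreal Q"
    unfolding G_eq J Q_eq using A E \<I> by (simp add: ennreal_mult)
  have Q0: "0 \<le> Q"
    unfolding Q_eq using A E \<I> by simp
  have le: "(P / C)\<^sup>2 * Q \<le> 1" and ge: "1 \<le> (C * P)\<^sup>2 * Q"
    using G_le G_ge Q0 unfolding GQ by (simp_all flip: ennreal_mult)
  \<comment> \<open>If \<open>Q\<close> were 0, the bound \<open>ge\<close> would read
    \<open>1 \<le> 0\<close>. Positivity permits the division by \<open>sqrt Q\<close> at the
    end.\<close>
  have Q: "0 < Q"
    using ge Q0 by (cases "Q = 0") auto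
  have "sqrt ((P / C)\<^sup>2 * Q) \<le> 1" and "1 \<le> sqrt ((C * P)\<^sup>2 * Q)"
    using le ge by simp_all
  then have "P / C * sqrt Q \<le> 1" and "1 \<le> C * P * sqrt Q"
    using P C by (simp_all add: real_sqrt_mult)
  moreover have Q_powr: "Q powr (- 1/2) = 1 / sqrt Q"
    using powr_minus_divide[of Q "1/2"] powr_half_sqrt[of Q] Q by simp
  ultimately show ?thesis
    unfolding P_def[symmetric] Q_powr using C Q by (simp add: divide_simps mult_ac)
qed

end
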